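(* Let $\mathcal C=\mathbb R^3\times\mathbb S^2$, with points $(\vec r,\vec n)$, $\vec r\in\mathbb R^3$, $\vec n\in\mathbb S^2\subset\mathbb R^3$ a unit vector, and let $\omega^0=\vec n\cdot \mathrm d\vec r$, a 1-form on $\mathcal C$. Let $\mathcal D=\ker\omega^0$ be the rank 4 distribution annihilated by $\omega^0$ (i.e. the distribution of velocities satisfying $\dot{\vec r}\perp\vec n$). Then $(\mathcal C,\mathcal D)$ is a contact manifold, i.e. $\mathrm d\omega^0\wedge\mathrm d\omega^0\wedge\omega^0$ vanishes nowhere on $\mathcal C$; the form $\omega^0$ is determined by $\mathcal D$ up to scale, and the restriction of $\Omega=\mathrm d\omega^0$ to $\mathcal D$ is a nondegenerate 2-form on $\mathcal D$, determined by $\mathcal D$ up to scale.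
   Context: $\mathcal C=\mathbb R^3\times\mathbb S^2$ is the configuration space of a "flying saucer" (a disc in 3-space with centre $\vec r$ and unit normal $\vec n$) that is not allowed to move in the direction perpendicular to its disc, i.e. $\dot{\vec r}(t)\perp\vec n(t)$. Here $\vec n\cdot\mathrm d\vec r=n_x\mathrm dx+n_y\mathrm dy+n_z\mathrm dz$, where $\vec r=(x,y,z)$ and $\vec n=(n_x,n_y,n_z)$. "Up to scale" means up to multiplication by a nowhere vanishing function. *)

theory Defs
  imports "HOL-Analysis.Analysis"
begin

section \<open>Smooth maps\<close>

primrec Ck_on :: "nat \<Rightarrow> 'a::real_normed_vector set \<Rightarrow> ('a \<Rightarrow> 'b::real_normed_vector) \<Rightarrow> bool" where
  "Ck_on 0 U f \<longleftrightarrow> continuous_on U f"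
| "Ck_on (Suc k) U f \<longleftrightarrow>
     (\<forall>x\<in>U. f differentiable (at x)) \<and> (\<forall>v. Ck_on k U (\<lambda>x. frechet_derivative f (at x) v))"

text \<open>Only used for open subsets of Euclidean spaces.\<close>
definition smooth_on :: "'a::euclidean_space set \<Rightarrow> ('a \<Rightarrow> 'b::euclidean_space) \<Rightarrow> bool" where
  "smooth_on U f \<longleftrightarrow> (\<forall>k. Ck_on k U f)"


section \<open>Smooth objects on a submanifold of a Euclidean space\<close>

text \<open>In this section \<open>S\<close> is thought of as an embedded submanifold of the Euclidean space
  \<open>'a\<close>. Smooth functions and forms on \<open>S\<close> are those which locally extend to smooth functions
  and forms on an open subset of \<open>'a\<close>; for embedded submanifolds this agrees with smoothness
  in charts.\<close>

definition tangent_space :: "'a::euclidean_space set \<Rightarrow> 'a \<Rightarrow> 'a set" where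
  "tangent_space S p =
     {v. \<exists>\<gamma> e. e > 0 \<and> smooth_on {-e<..<e} \<gamma> \<and> \<gamma> ` {-e<..<e} \<subseteq> S \<and> \<gamma> 0 = p \<and>
               (\<gamma> has_vector_derivative v) (at (0::real))}"

definition smooth_function :: "'a::euclidean_space set \<Rightarrow> ('a \<Rightarrow> real) \<Rightarrow> bool" where
  "smooth_function S f \<longleftrightarrow>
     (\<forall>p\<in>S. \<exists>U g. open U \<and> p \<in> U \<and> smooth_on U g \<and> (\<forall>q\<in>S \<inter> U. f q = g q))"

text \<open>A form of degree \<open>k\<close> on \<open>S\<close> is evaluated at a point of \<open>S\<close> on a list of \<open>k\<close> tangent
  vectors. Its values on other arguments carry no meaning, so two forms are equal on \<open>S\<close> when
  they agree at all points of \<open>S\<close> on all lists of \<open>k\<close> tangent vectors.\<close>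

type_synonym 'a form = "'a \<Rightarrow> 'a list \<Rightarrow> real"

text \<open>\<open>\<alpha>\<close> is a smooth 1-form on an open neighbourhood of \<open>p\<close> in the ambient space whose pullback
  to \<open>S\<close> is \<open>\<omega>\<close> near \<open>p\<close>.\<close>
definition local_extension ::
    "'a::euclidean_space set \<Rightarrow> 'a form \<Rightarrow> 'a \<Rightarrow> 'a form \<Rightarrow> bool" where
  "local_extension S \<omega> p \<alpha> \<longleftrightarrow>
     (\<exists>U. open U \<and> p \<in> U \<and>
          (\<forall>x\<in>U. linear (\<lambda>v. \<alpha> x [v])) \<and>
          (\<forall>v. smooth_on U (\<lambda>x. \<alpha> x [v])) \<and>
          (\<forall>q\<in>S \<inter> U. \<forall>v\<in>tangent_space S q. \<omega> q [v] = \<alpha> q [v]))"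

definition smooth_one_form :: "'a::euclidean_space set \<Rightarrow> 'a form \<Rightarrow> bool" where
  "smooth_one_form S \<omega> \<longleftrightarrow> (\<forall>p\<in>S. \<exists>\<alpha>. local_extension S \<omega> p \<alpha>)"

text \<open>The exterior derivative of a 1-form in the ambient space, with the convention
  \<open>d\<alpha>(u,v) = D\<^sub>u(\<alpha>(v)) - D\<^sub>v(\<alpha>(u))\<close> for constant vector fields \<open>u\<close>, \<open>v\<close>.\<close>
definition ambient_d :: "'a::euclidean_space form \<Rightarrow> 'a form" where
  "ambient_d \<alpha> p vs =
     frechet_derivative (\<lambda>x. \<alpha> x [vs ! 1]) (at p) (vs ! 0) -
     frechet_derivative (\<lambda>x. \<alpha> x [vs ! 0]) (at p) (vs ! 1)"

text \<open>The exterior derivative of a 1-form on \<open>S\<close>. As \<open>d\<close> commutes with pullback along the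
  inclusion of \<open>S\<close>, the value on tangent vectors does not depend on the extension.\<close>
definition ext_d :: "'a::euclidean_space set \<Rightarrow> 'a form \<Rightarrow> 'a form" where
  "ext_d S \<omega> p vs = (THE c. \<exists>\<alpha>. local_extension S \<omega> p \<alpha> \<and> c = ambient_d \<alpha> p vs)"

text \<open>The wedge product of a \<open>k\<close>-form and an \<open>l\<close>-form, normalised so that
  \<open>(\<alpha> \<and> \<beta>)(u,v) = \<alpha>(u) \<beta>(v) - \<alpha>(v) \<beta>(u)\<close> for 1-forms.\<close>
definition wedge :: "nat \<Rightarrow> nat \<Rightarrow> 'a form \<Rightarrow> 'a form \<Rightarrow> 'a form" where
  "wedge k l \<alpha> \<beta> p vs =
     (\<Sum>\<pi> | \<pi> permutes {..<k + l}. of_int (sign \<pi>) *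
        \<alpha> p (map (\<lambda>i. vs ! \<pi> i) [0..<k]) * \<beta> p (map (\<lambda>i. vs ! \<pi> i) [k..<k + l]))
     / (fact k * fact l)"

definition nonzero_form_at :: "'a::euclidean_space set \<Rightarrow> nat \<Rightarrow> 'a form \<Rightarrow> 'a \<Rightarrow> bool" where
  "nonzero_form_at S k \<alpha> p \<longleftrightarrow>
     (\<exists>vs. length vs = k \<and> set vs \<subseteq> tangent_space S p \<and> \<alpha> p vs \<noteq> 0)"

text \<open>Smooth distributions of rank \<open>k\<close>, given by local frames.\<close>
definition smooth_distribution ::
    "'a::euclidean_space set \<Rightarrow> nat \<Rightarrow> ('a \<Rightarrow> 'a set) \<Rightarrow> bool" where
  "smooth_distribution S k D \<longleftrightarrow>
     (\<forall>p\<in>S. \<exists>U X. open U \<and> p \<in> U \<and> (\<forall>i<k. smooth_on U (X i)) \<and>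
        (\<forall>q\<in>S \<inter> U. D q \<subseteq> tangent_space S q \<and> D q = span ((\<lambda>i. X i q) ` {..<k}) \<and> dim (D q) = k))"

definition form_kernel :: "'a::euclidean_space set \<Rightarrow> 'a form \<Rightarrow> 'a \<Rightarrow> 'a set" where
  "form_kernel S \<omega> p = {v \<in> tangent_space S p. \<omega> p [v] = 0}"

definition nondegenerate_on :: "'a::real_vector set \<Rightarrow> ('a list \<Rightarrow> real) \<Rightarrow> bool" where
  "nondegenerate_on V b \<longleftrightarrow> (\<forall>u\<in>V. (\<forall>v\<in>V. b [u, v] = 0) \<longrightarrow> u = 0)"


section \<open>The flying saucer\<close>

text \<open>Points \<open>(r, n)\<close>: the centre \<open>r\<close> and the unit normal \<open>n\<close> of the disc.\<close>
definition saucer_space :: "((real^3) \<times> (real^3)) set" where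
  "saucer_space = UNIV \<times> sphere 0 1"

text \<open>The 1-form \<open>n \<bullet> dr\<close>.\<close>
definition omega0 :: "((real^3) \<times> (real^3)) form" where
  "omega0 p vs = snd p \<bullet> fst (vs ! 0)"

definition saucer_distribution :: "(real^3) \<times> (real^3) \<Rightarrow> ((real^3) \<times> (real^3)) set" where
  "saucer_distribution = form_kernel saucer_space omega0"

abbreviation Omega :: "((real^3) \<times> (real^3)) form" where
  "Omega \<equiv> ext_d saucer_space omega0"

end

theory Submission
  imports Defs
begin

text \<open>The tangent space at \<open>(r, n)\<close> consists of the \<open>(a, b)\<close> with \<open>b\<close> orthogonal to \<open>n\<close>, and the
  distribution of those where \<open>a\<close> is orthogonal to \<open>n\<close> too. On tangent vectors
  \<open>\<Omega> ((a, b), (a', b')) = b \<bullet> a' - b' \<bullet> a\<close>, and pairing \<open>(a, b)\<close> with \<open>(b, -a)\<close> in the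
  distribution gives \<open>|a|\<^sup>2 + |b|\<^sup>2\<close>, whence nondegeneracy. The field \<open>(n, 0)\<close> is transverse to the
  distribution with \<open>\<omega>\<^sup>0 (n, 0) = 1\<close>, so a form \<open>\<omega>\<close> with the same kernel equals \<open>f \<omega>\<^sup>0\<close> for
  \<open>f = \<omega> (n, 0)\<close>; on the distribution the term \<open>df \<and> \<omega>\<^sup>0\<close> of \<open>d\<omega>\<close> vanishes, leaving \<open>f \<Omega>\<close>.\<close>

section \<open>Smooth maps\<close>

lemma Ck_on_cong:
  assumes "open U"
  shows "Ck_on k U f \<Longrightarrow> (\<And>x. x \<in> U \<Longrightarrow> f x = g x) \<Longrightarrow> Ck_on k U g"
proof (induction k arbitrary: f g)
  case 0
  then show ?case using continuous_on_cong by force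
next
  case (Suc k)
  have *: "(g has_derivative frechet_derivative f (at x)) (at x)" if "x \<in> U" for x
    using has_derivative_transform_within_open[OF _ assms that, of f "frechet_derivative f (at x)" UNIV g] Suc.prems that
    by (auto simp: frechet_derivative_works)
  then have "frechet_derivative f (at x) v = frechet_derivative g (at x) v" if "x \<in> U" for x v
    using frechet_derivative_at that by metis
  then have "Ck_on k U (\<lambda>x. frechet_derivative g (at x) v)" for v
    using Suc.IH[of "\<lambda>x. frechet_derivative f (at x) v" "\<lambda>x. frechet_derivative g (at x) v"]
      Suc.prems(1) by simp
  with * show ?case by (auto simp: differentiable_def)
qed

text \<open>Uniqueness of derivatives lets an explicitly computed \<open>f'\<close> stand for
  \<open>frechet_derivative\<close>, so that inductions on \<open>k\<close> can use the usual
  calculus rules.\<close>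

lemma Ck_on_SucI:
  assumes f': "\<And>x. x \<in> U \<Longrightarrow> (f has_derivative f' x) (at x)" and U: "open U"
    and Ck: "\<And>v. Ck_on k U (\<lambda>x. f' x v)"
  shows "Ck_on (Suc k) U f"
proof -
  have "f' x v = frechet_derivative f (at x) v" if "x \<in> U" for x v
    using frechet_derivative_at[OF f'[OF that]] by simp
  then have "Ck_on k U (\<lambda>x. frechet_derivative f (at x) v)" for v
    by (rule Ck_on_cong[OF U Ck])
  with f' show ?thesis by (auto simp: differentiable_def)
qed

lemma Ck_on_SucD: "Ck_on (Suc k) U f \<Longrightarrow> Ck_on k U f"
proof (induction k arbitrary: f)
  case 0
  then show ?case
    by (auto intro!: continuous_at_imp_continuous_on differentiable_imp_continuous_within)
qed auto

lemma Ck_on_subset: "V \<subseteq> U \<Longrightarrow> Ck_on k U f \<Longrightarrow> Ck_on k V f"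
  by (induction k arbitrary: f) (auto intro: continuous_on_subset)

lemma Ck_on_const: "open U \<Longrightarrow> Ck_on k U (\<lambda>x. c)"
proof (induction k arbitrary: c)
  case (Suc k)
  show ?case
    by (rule Ck_on_SucI[where f' = "\<lambda>_ _. 0"]) (use Suc in auto)
qed auto

lemma Ck_on_bounded_linear:
  assumes "open U" "bounded_linear f"
  shows "Ck_on k U f"
proof (cases k)
  case 0
  then show ?thesis using assms by (simp add: linear_continuous_on)
next
  case (Suc m)
  show ?thesis unfolding Suc
    by (rule Ck_on_SucI[where f' = "\<lambda>_. f"])
       (use assms in \<open>auto intro: bounded_linear_imp_has_derivative Ck_on_const\<close>)
qed

lemma Ck_on_add:
  assumes "open U"
  shows "Ck_on k U f \<Longrightarrow> Ck_on k U g \<Longrightarrow> Ck_on k U (\<lambda>x. f x + g x)"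
proof (induction k arbitrary: f g)
  case (Suc k)
  show ?case
    by (rule Ck_on_SucI[where
          f' = "\<lambda>x v. frechet_derivative f (at x) v + frechet_derivative g (at x) v"])
       (use Suc assms in \<open>auto simp: frechet_derivative_works intro!: has_derivative_add\<close>)
qed (auto intro: continuous_on_add)

text \<open>The product rule gives a sum of two products of the same kind. The induction hypothesis
  applies to each, with the undifferentiated factor lowered to class \<open>k\<close> by
  \<open>Ck_on_SucD\<close>.\<close>

lemma Ck_on_bilinear:
  assumes "open U" "bounded_bilinear mul"
  shows "Ck_on k U f \<Longrightarrow> Ck_on k U g \<Longrightarrow> Ck_on k U (\<lambda>x. mul (f x) (g x))"
proof (induction k arbitrary: f g)
  case 0
  then show ?case using bounded_bilinear.continuous_on[OF assms(2)] by auto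
next
  case (Suc k)
  show ?case
    by (rule Ck_on_SucI[where f' = "\<lambda>x v. mul (f x) (frechet_derivative g (at x) v)
              + mul (frechet_derivative f (at x) v) (g x)"])
       (use Suc assms Ck_on_SucD[OF Suc.prems(1)] Ck_on_SucD[OF Suc.prems(2)] in
         \<open>auto simp: frechet_derivative_works intro!: bounded_bilinear.FDERIV[OF assms(2)] Ck_on_add\<close>)
qed

lemma smooth_on_subset: "smooth_on U f \<Longrightarrow> V \<subseteq> U \<Longrightarrow> smooth_on V f"
  by (auto simp: smooth_on_def intro: Ck_on_subset)

lemma smooth_on_cong: "smooth_on U f \<Longrightarrow> open U \<Longrightarrow> (\<And>x. x \<in> U \<Longrightarrow> f x = g x) \<Longrightarrow> smooth_on U g"
  unfolding smooth_on_def using Ck_on_cong[of U _ f g] by blast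

lemma smooth_on_const: "open U \<Longrightarrow> smooth_on U (\<lambda>x. c)"
  by (simp add: smooth_on_def Ck_on_const)

lemma smooth_on_bounded_linear: "bounded_linear f \<Longrightarrow> open U \<Longrightarrow> smooth_on U f"
  by (simp add: smooth_on_def Ck_on_bounded_linear)

lemma smooth_on_add:
  "smooth_on U f \<Longrightarrow> smooth_on U g \<Longrightarrow> open U \<Longrightarrow> smooth_on U (\<lambda>x. f x + g x)"
  by (simp add: smooth_on_def Ck_on_add)

lemma smooth_on_bilinear:
  "bounded_bilinear mul \<Longrightarrow> smooth_on U f \<Longrightarrow> smooth_on U g \<Longrightarrow> open U
    \<Longrightarrow> smooth_on U (\<lambda>x. mul (f x) (g x))"
  by (simp add: smooth_on_def Ck_on_bilinear)

lemma smooth_on_sum: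
  assumes "open U" "\<And>i. i \<in> I \<Longrightarrow> smooth_on U (f i)"
  shows "smooth_on U (\<lambda>x. \<Sum>i\<in>I. f i x)"
  using assms(2)
  by (induction I rule: infinite_finite_induct) (auto intro: smooth_on_const smooth_on_add assms(1))

lemma smooth_on_has_derivative:
  "smooth_on U f \<Longrightarrow> x \<in> U \<Longrightarrow> (f has_derivative frechet_derivative f (at x)) (at x)"
  unfolding smooth_on_def using Ck_on.simps(2)[of 0 U f] by (auto simp: frechet_derivative_works)

text \<open>Linearity expands the form in the standard basis, which separates the moving argument
  \<open>W x\<close> from the smooth coefficients \<open>\<alpha> x [i]\<close>.\<close>

lemma smooth_on_form_apply:
  fixes \<alpha> :: "'a::euclidean_space form"
  assumes U: "open U" and lin: "\<And>x. x \<in> U \<Longrightarrow> linear (\<lambda>v. \<alpha> x [v])"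
    and \<alpha>: "\<And>v. smooth_on U (\<lambda>x. \<alpha> x [v])" and W: "smooth_on U W"
  shows "smooth_on U (\<lambda>x. \<alpha> x [W x])"
proof (rule smooth_on_cong[OF _ U])
  show "smooth_on U (\<lambda>x. \<Sum>i\<in>Basis. (W x \<bullet> i) * \<alpha> x [i])"
    by (intro smooth_on_sum smooth_on_bilinear[OF bounded_bilinear_mult]
        smooth_on_bilinear[OF bounded_bilinear_inner] smooth_on_const \<alpha> W U)
  fix x assume "x \<in> U"
  then show "(\<Sum>i\<in>Basis. (W x \<bullet> i) * \<alpha> x [i]) = \<alpha> x [W x]"
    using Linear_Algebra.linear_componentwise[OF lin, of x "W x" 1] by simp
qed

text \<open>The family is closed under differentiation: \<open>(A, B, C, D)\<close> turns into
  \<open>(h B, 0, h c D, - h c C)\<close>, so the induction runs over all coefficients at once.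
  Curves realising tangent vectors are taken from it.\<close>

lemma smooth_on_trig_curve:
  fixes A B C D :: "'a::euclidean_space"
  shows "smooth_on UNIV (\<lambda>t::real. A + t *\<^sub>R B + cos (c * t) *\<^sub>R C + sin (c * t) *\<^sub>R D)"
proof -
  have "Ck_on k UNIV (\<lambda>t::real. A + t *\<^sub>R B + cos (c * t) *\<^sub>R C + sin (c * t) *\<^sub>R D)" for k
  proof (induction k arbitrary: A B C D)
    case 0
    then show ?case by (auto intro!: continuous_intros)
  next
    case (Suc k)
    show ?case
    proof (rule Ck_on_SucI)
      fix t :: real
      show "((\<lambda>t::real. A + t *\<^sub>R B + cos (c * t) *\<^sub>R C + sin (c * t) *\<^sub>R D) has_derivative
          (\<lambda>h. h *\<^sub>R B + t *\<^sub>R 0 + cos (c * t) *\<^sub>R (h * c) *\<^sub>R D + sin (c * t) *\<^sub>R (- h * c) *\<^sub>R C)) (at t)"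
        by (auto intro!: derivative_eq_intros simp: algebra_simps)
      show "Ck_on k UNIV (\<lambda>t. h *\<^sub>R B + t *\<^sub>R 0 + cos (c * t) *\<^sub>R (h * c) *\<^sub>R D + sin (c * t) *\<^sub>R (- h * c) *\<^sub>R C)" for h
        by (rule Suc)
    qed simp
  qed
  then show ?thesis by (simp add: smooth_on_def)
qed

section \<open>Wedge products\<close>

text \<open>The alternation comes from the sum over all permutations: composing with
  \<open>\<pi>\<close> reindexes that sum and changes every sign by
  \<open>sign \<pi>\<close>.\<close>

lemma wedge_permute:
  assumes \<pi>: "\<pi> permutes {..<k + l}"
  shows "wedge k l \<alpha> \<beta> p (map (\<lambda>i. vs ! \<pi> i) [0..<k + l]) = of_int (sign \<pi>) * wedge k l \<alpha> \<beta> p vs"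
proof -
  define t where "t \<rho> = of_int (sign \<rho>) *
        \<alpha> p (map (\<lambda>i. vs ! \<rho> i) [0..<k]) * \<beta> p (map (\<lambda>i. vs ! \<rho> i) [k..<k + l])" for \<rho>
  have *: "of_int (sign \<rho>) * \<alpha> p (map (\<lambda>i. map (\<lambda>i. vs ! \<pi> i) [0..<k + l] ! \<rho> i) [0..<k])
      * \<beta> p (map (\<lambda>i. map (\<lambda>i. vs ! \<pi> i) [0..<k + l] ! \<rho> i) [k..<k + l])
      = of_int (sign \<pi>) * t (\<pi> \<circ> \<rho>)" if \<rho>: "\<rho> permutes {..<k + l}" for \<rho>
  proof -
    have lt: "\<rho> i < k + l" if "i < k + l" for i
      using permutes_in_image[OF \<rho>, of i] that by simp
    have "map (\<lambda>i. map (\<lambda>i. vs ! \<pi> i) [0..<k + l] ! \<rho> i) [0..<k] = map (\<lambda>i. vs ! (\<pi> \<circ> \<rho>) i) [0..<k]"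
      "map (\<lambda>i. map (\<lambda>i. vs ! \<pi> i) [0..<k + l] ! \<rho> i) [k..<k+l] = map (\<lambda>i. vs ! (\<pi> \<circ> \<rho>) i) [k..<k+l]"
      by (auto simp: lt simp del: upt_add_eq_append)
    \<comment> \<open>Signs are multiplicative and \<open>sign \<pi>\<close> squares to 1.\<close>
    moreover have "sign \<rho> = sign \<pi> * sign (\<pi> \<circ> \<rho>)"
      using \<pi> \<rho> by (subst sign_compose) (auto simp: permutation_permutes sign_def)
    ultimately show ?thesis
      unfolding t_def by (simp only: of_int_mult mult.assoc)
  qed
  have "(\<Sum>\<rho> | \<rho> permutes {..<k + l}. of_int (sign \<rho>) * \<alpha> p (map (\<lambda>i. map (\<lambda>i. vs ! \<pi> i) [0..<k + l] ! \<rho> i) [0..<k])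
      * \<beta> p (map (\<lambda>i. map (\<lambda>i. vs ! \<pi> i) [0..<k + l] ! \<rho> i) [k..<k + l]))
      = (\<Sum>\<rho> | \<rho> permutes {..<k + l}. of_int (sign \<pi>) * t (\<pi> \<circ> \<rho>))"
    by (rule sum.cong) (use * in auto)
  also have "\<dots> = of_int (sign \<pi>) * (\<Sum>\<rho> | \<rho> permutes {..<k + l}. t \<rho>)"
    unfolding sum_distrib_left[symmetric]
    using setum_permutations_compose_left[OF \<pi>, of t] by simp
  finally show ?thesis
    by (simp add: wedge_def t_def)
qed

text \<open>A permutation that moves \<open>k\<close> hands one of the first \<open>k\<close>
  vectors to \<open>\<beta>\<close>, which kills it. The remaining \<open>k!\<close> terms agree by
  alternation and cancel the normalising factor.\<close>

lemma wedge_one_form_right: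
  assumes len: "length vs = Suc k"
    and alt: "\<And>\<pi>. \<pi> permutes {..<k} \<Longrightarrow> \<alpha> p (map (\<lambda>i. vs ! \<pi> i) [0..<k]) = of_int (sign \<pi>) * \<alpha> p (take k vs)"
    and zero: "\<And>i. i < k \<Longrightarrow> \<beta> p [vs ! i] = 0"
  shows "wedge k 1 \<alpha> \<beta> p vs = \<alpha> p (take k vs) * \<beta> p [vs ! k]"
proof -
  let ?t = "\<lambda>\<pi>. of_int (sign \<pi>) * \<alpha> p (map (\<lambda>i. vs ! \<pi> i) [0..<k]) * \<beta> p (map (\<lambda>i. vs ! \<pi> i) [k..<k + 1])"
  have "(\<Sum>\<pi> | \<pi> permutes {..<k + 1}. ?t \<pi>) = (\<Sum>\<pi> | \<pi> permutes {..<k}. ?t \<pi>)"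
  proof (rule sum.mono_neutral_right)
    show "finite {\<pi>. \<pi> permutes {..<k + 1}}" by (simp add: finite_permutations)
    show "{\<pi>. \<pi> permutes {..<k}} \<subseteq> {\<pi>. \<pi> permutes {..<k + 1}}"
      by (auto intro: permutes_subset)
    show "\<forall>\<pi>\<in>{\<pi>. \<pi> permutes {..<k + 1}} - {\<pi>. \<pi> permutes {..<k}}. ?t \<pi> = 0"
    proof
      fix \<pi> assume \<pi>: "\<pi> \<in> {\<pi>. \<pi> permutes {..<k + 1}} - {\<pi>. \<pi> permutes {..<k}}"
      have "\<pi> k \<noteq> k"
        using \<pi> permutes_superset[of \<pi> "{..<k + 1}" "{..<k}"] by (auto simp: less_Suc_eq)
      moreover have "\<pi> k < k + 1"
        using \<pi> permutes_in_image[of \<pi> "{..<k + 1}" k] by simp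
      ultimately show "?t \<pi> = 0"
        using zero[of "\<pi> k"] by simp
    qed
  qed
  also have "\<dots> = (\<Sum>\<pi> | \<pi> permutes {..<k}. \<alpha> p (take k vs) * \<beta> p [vs ! k])"
  proof (rule sum.cong)
    fix \<pi> assume "\<pi> \<in> {\<pi>. \<pi> permutes {..<k}}"
    then have "\<pi> k = k" "\<pi> permutes {..<k}" by (auto simp: permutes_def)
    then show "?t \<pi> = \<alpha> p (take k vs) * \<beta> p [vs ! k]"
      using alt[of \<pi>] by (simp add: sign_def)
  qed simp
  also have "\<dots> = fact k * (\<alpha> p (take k vs) * \<beta> p [vs ! k])"
    by (simp add: card_permutations)
  finally show ?thesis by (simp add: wedge_def)
qed

text \<open>The table is that of a symplectic basis up to sign. Of the 24 permutations only the 8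
  preserving the splitting into \<open>{0, 1}\<close> and \<open>{2, 3}\<close> contribute, each
  with 1, and \<open>8 / (2! * 2!) = 2\<close>.\<close>

lemma wedge_two_forms_four_vectors:
  fixes \<alpha> :: "'a form"
  assumes "\<And>i j. \<lbrakk>i < 4; j < 4\<rbrakk> \<Longrightarrow> \<alpha> p [vs ! i, vs ! j] =
     (if (i, j) = (0, 1) \<or> (i, j) = (2, 3) then -1 else if (i, j) = (1, 0) \<or> (i, j) = (3, 2) then 1 else 0)"
  shows "wedge 2 2 \<alpha> \<alpha> p vs = 2"
proof -
  \<comment> \<open>Written with \<open>insert\<close>, the index set lets
    \<open>sum_over_permutations_insert\<close> unroll the sum into explicit products of
    transpositions.\<close>
  have s: "{..<2 + 2} = insert 0 (insert 1 (insert 2 (insert (3::nat) {})))" by auto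
  have u: "[0..<2] = [0, 1]" "[2..<2+2] = [2, Suc 2]" by (simp_all add: upt_rec)
  have f: "finite {1, 2, 3::nat}" "0 \<notin> {1, 2, 3::nat}" "finite {2, 3::nat}" "1 \<notin> {2, 3::nat}"
    "finite {3::nat}" "2 \<notin> {3::nat}" by auto
  show ?thesis
    unfolding wedge_def u
    unfolding s sum_over_permutations_insert[OF f(1,2)] sum_over_permutations_insert[OF f(3,4)]
      sum_over_permutations_insert[OF f(5,6)] permutes_sing
    by (simp add: sign_compose permutation_swap_id permutation_compose sign_swap_id sign_id)
       (simp add: transpose_def assms)
qed

section \<open>The flying saucer\<close>

text \<open>One inclusion differentiates \<open>|n|^2 = 1\<close> along a curve. For the other, the
  centre moves on a straight line while the normal follows a great circle.\<close>

lemma saucer_tangent_space: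
  assumes "p \<in> saucer_space"
  shows "tangent_space saucer_space p = {v. snd p \<bullet> snd v = 0}"
proof (intro set_eqI iffI)
  fix v assume "v \<in> tangent_space saucer_space p"
  then obtain \<gamma> e where \<gamma>: "e > 0" "\<gamma> ` {-e<..<e} \<subseteq> saucer_space" "\<gamma> 0 = p"
    "(\<gamma> has_vector_derivative v) (at (0::real))"
    unfolding tangent_space_def by blast
  have "snd (\<gamma> t) \<bullet> snd (\<gamma> t) = 1" if "t \<in> {-e<..<e}" for t
    using \<gamma>(2) that by (force simp: saucer_space_def dot_square_norm)
  moreover have "((\<lambda>t. 1) has_vector_derivative (0::real)) (at (0::real))" by simp
  ultimately have "((\<lambda>t. snd (\<gamma> t) \<bullet> snd (\<gamma> t)) has_vector_derivative 0) (at 0)"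
    using \<gamma>(1) has_vector_derivative_transform_within_open[of "\<lambda>t. 1" 0 0 "{-e<..<e}" "\<lambda>t. snd (\<gamma> t) \<bullet> snd (\<gamma> t)"] by auto
  moreover have "((\<lambda>t. snd (\<gamma> t)) has_vector_derivative snd v) (at 0)"
    using bounded_linear.has_vector_derivative[OF bounded_linear_snd \<gamma>(4)] .
  then have "((\<lambda>t. snd (\<gamma> t) \<bullet> snd (\<gamma> t)) has_vector_derivative
      (snd p \<bullet> snd v + snd v \<bullet> snd p)) (at 0)"
    using bounded_bilinear.has_vector_derivative[OF bounded_bilinear_inner] \<gamma>(3) by fastforce
  ultimately have "snd p \<bullet> snd v + snd v \<bullet> snd p = 0"
    using vector_derivative_unique_at by blast
  then show "v \<in> {v. snd p \<bullet> snd v = 0}" by (simp add: inner_commute)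
next
  fix v :: "(real^3) \<times> (real^3)" assume "v \<in> {v. snd p \<bullet> snd v = 0}"
  then have v: "snd p \<bullet> snd v = 0" by simp
  have p: "snd p \<bullet> snd p = 1"
    using assms by (auto simp: saucer_space_def dot_square_norm)
  \<comment> \<open>\<open>c\<close> is the angular speed on the great circle. Since
    \<open>inverse 0 = 0\<close>, the formula for \<open>\<gamma>\<close> also covers
    \<open>snd v = 0\<close>, where the normal stays fixed.\<close>
  define c where "c = norm (snd v)"
  have c: "snd v \<bullet> snd v = c * c" by (simp add: c_def dot_square_norm power2_eq_square)
  have c0: "c *\<^sub>R (inverse c *\<^sub>R snd v) = snd v" by (cases "c = 0") (auto simp: c_def)
  define \<gamma> where "\<gamma> t = (fst p, 0) + t *\<^sub>R (fst v, 0) + cos (c * t) *\<^sub>R (0, snd p)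
    + sin (c * t) *\<^sub>R (0, inverse c *\<^sub>R snd v)" for t
  have "smooth_on {-1<..<1} \<gamma>"
    unfolding \<gamma>_def using smooth_on_trig_curve by (rule smooth_on_subset) simp
  moreover have "\<gamma> t \<in> saucer_space" for t
  proof -
    have "snd (\<gamma> t) \<bullet> snd (\<gamma> t) = (cos (c * t))\<^sup>2 + (sin (c * t))\<^sup>2 * (inverse c * inverse c * (c * c))"
      by (simp add: \<gamma>_def inner_add_left inner_add_right v p inner_commute[of "snd v" "snd p"] c power2_eq_square)
    \<comment> \<open>For \<open>c = 0\<close> the bracket is 0 instead of 1, but then the sine
      vanishes and the cosine is 1.\<close>
    also have "\<dots> = 1"
      by (cases "c = 0") (simp_all add: field_simps)
    finally show ?thesis
      by (cases "\<gamma> t") (simp add: saucer_space_def norm_eq_1)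
  qed
  moreover have "\<gamma> 0 = p" by (simp add: \<gamma>_def prod_eq_iff)
  moreover have "(\<gamma> has_vector_derivative
      (fst v, 0) + c *\<^sub>R (0, inverse c *\<^sub>R snd v)) (at 0)"
    unfolding \<gamma>_def by (auto intro!: derivative_eq_intros simp: scaleR_prod_def)
  then have "(\<gamma> has_vector_derivative v) (at 0)"
    using c0 by (simp add: scaleR_prod_def)
  ultimately show "v \<in> tangent_space saucer_space p"
    unfolding tangent_space_def by (intro CollectI exI[of _ \<gamma>] exI[of _ 1]) auto
qed

lemma saucer_distribution_eq:
  assumes "p \<in> saucer_space"
  shows "saucer_distribution p = {v. snd p \<bullet> fst v = 0 \<and> snd p \<bullet> snd v = 0}"
  using saucer_tangent_space[OF assms] by (auto simp: saucer_distribution_def form_kernel_def omega0_def)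

section \<open>Exterior derivatives of 1-forms on the configuration space\<close>

text \<open>\<open>V q = (fst v, snd v - (snd v \<bullet> snd q) *\<^sub>R snd q)\<close> is a tangent vector field through \<open>v\<close>.
  The left-hand function only involves \<open>\<omega>\<close>, and the correction term on the right is symmetric
  in \<open>u\<close> and \<open>v\<close>, so it cancels in the exterior derivative.\<close>
lemma saucer_extension_derivative:
  assumes ext: "local_extension saucer_space \<omega> p \<alpha>"
    and e: "e > 0" and \<gamma>S: "\<gamma> ` {-e<..<e} \<subseteq> saucer_space" and \<gamma>0: "\<gamma> 0 = p"
    and \<gamma>': "(\<gamma> has_vector_derivative u) (at (0::real))"
    and v: "v \<in> tangent_space saucer_space p"
  shows "((\<lambda>t. \<omega> (\<gamma> t) [(fst v, snd v - (snd v \<bullet> snd (\<gamma> t)) *\<^sub>R snd (\<gamma> t))]) has_real_derivative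
    frechet_derivative (\<lambda>x. \<alpha> x [v]) (at p) u - (snd u \<bullet> snd v) * \<alpha> p [(0, snd p)]) (at 0)"
proof -
  from ext obtain U where U: "open U" "p \<in> U" and lin: "\<And>x. x \<in> U \<Longrightarrow> linear (\<lambda>v. \<alpha> x [v])"
    and sm: "\<And>v. smooth_on U (\<lambda>x. \<alpha> x [v])"
    and eq: "\<And>q v. q \<in> saucer_space \<inter> U \<Longrightarrow> v \<in> tangent_space saucer_space q \<Longrightarrow> \<omega> q [v] = \<alpha> q [v]"
    unfolding local_extension_def by blast
  have p: "p \<in> saucer_space" using \<gamma>S \<gamma>0 e by force
  have pv: "snd v \<bullet> snd p = 0"
    using v saucer_tangent_space[OF p] by (simp add: inner_commute)
  \<comment> \<open>By linearity \<open>F x\<close> is \<open>\<alpha> x [V x]\<close> on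
    \<open>U\<close>, now defined off the manifold and hence differentiable in all ambient
    directions.\<close>
  define F where "F x = \<alpha> x [v] - (snd v \<bullet> snd x) * \<alpha> x [(0, snd x)]" for x
  have bl: "bounded_linear (\<lambda>x::(real^3)\<times>(real^3). (0::real^3, snd x))"
    by (intro bounded_linear_Pair bounded_linear_zero bounded_linear_snd)
  \<comment> \<open>The product rule multiplies this derivative by
    \<open>snd v \<bullet> snd p\<close>, which vanishes by \<open>pv\<close>.\<close>
  have G: "((\<lambda>x. \<alpha> x [(0, snd x)]) has_derivative frechet_derivative (\<lambda>x. \<alpha> x [(0, snd x)]) (at p)) (at p)"
    by (rule smooth_on_has_derivative[OF smooth_on_form_apply U(2)])
       (use lin sm U smooth_on_bounded_linear[OF bl U(1)] in auto)
  have "(F has_derivative (\<lambda>h. frechet_derivative (\<lambda>x. \<alpha> x [v]) (at p) h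
      - (snd h \<bullet> snd v) * \<alpha> p [(0, snd p)])) (at p)"
    unfolding F_def
    by (rule derivative_eq_intros smooth_on_has_derivative[OF sm U(2)] G refl)+
       (simp add: pv inner_commute[of _ "snd v"])
  then have der: "((F \<circ> \<gamma>) has_vector_derivative (frechet_derivative (\<lambda>x. \<alpha> x [v]) (at p) u
      - (snd u \<bullet> snd v) * \<alpha> p [(0, snd p)])) (at 0)"
    using \<gamma>0 vector_derivative_diff_chain_within[OF \<gamma>', of F] has_derivative_at_withinI by blast
  \<comment> \<open>The extension sees the curve only while it stays in \<open>U\<close>; agreement
    near 0 suffices for the derivative at 0.\<close>
  have ev: "\<forall>\<^sub>F t in nhds 0. (F \<circ> \<gamma>) t = \<omega> (\<gamma> t) [(fst v, snd v - (snd v \<bullet> snd (\<gamma> t)) *\<^sub>R snd (\<gamma> t))]"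
  proof -
    have "isCont \<gamma> 0"
      using \<gamma>' by (rule has_vector_derivative_continuous)
    then have "\<forall>\<^sub>F t in nhds 0. \<gamma> t \<in> U"
      using topological_tendstoD[of \<gamma> "\<gamma> 0" "nhds 0" U] U \<gamma>0
      unfolding isCont_def tendsto_at_iff_tendsto_nhds by simp
    moreover have "\<forall>\<^sub>F t in nhds 0. t \<in> {-e<..<e}"
      using e by (intro eventually_nhds_in_open) auto
    ultimately show ?thesis
    proof eventually_elim
      case (elim t)
      let ?q = "\<gamma> t" and ?V = "(fst v, snd v - (snd v \<bullet> snd (\<gamma> t)) *\<^sub>R snd (\<gamma> t))"
      have q: "?q \<in> saucer_space" using elim \<gamma>S by blast
      then have "snd ?q \<bullet> snd ?q = 1" by (auto simp: saucer_space_def dot_square_norm)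
      then have "?V \<in> tangent_space saucer_space ?q"
        using saucer_tangent_space[OF q] by (simp add: inner_diff_right inner_commute)
      then have "\<omega> ?q [?V] = \<alpha> ?q [?V]" using eq q elim by blast
      also have "\<dots> = F ?q"
      proof -
        have "?V = v - (snd v \<bullet> snd ?q) *\<^sub>R (0, snd ?q)"
          by (cases v) simp
        then show ?thesis
          using linear_diff[OF lin[OF elim(1)], of v]
            linear_scale[OF lin[OF elim(1)], of "snd v \<bullet> snd ?q" "(0, snd ?q)"]
          by (simp add: F_def)
      qed
      finally show ?case by simp
    qed
  qed
  have "\<forall>\<^sub>F t in nhds 0. t \<in> UNIV \<longrightarrow>
      (F \<circ> \<gamma>) t = \<omega> (\<gamma> t) [(fst v, snd v - (snd v \<bullet> snd (\<gamma> t)) *\<^sub>R snd (\<gamma> t))]"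
    using ev by simp
  from has_vector_derivative_cong_ev[OF this eventually_nhds_x_imp_x[OF ev]] der show ?thesis
    unfolding has_real_derivative_iff_has_vector_derivative by blast
qed

text \<open>This makes the definite description in \<open>ext_d\<close> meaningful on tangent
  vectors.\<close>

lemma saucer_ambient_d_unique:
  assumes p: "p \<in> saucer_space"
    and \<alpha>: "local_extension saucer_space \<omega> p \<alpha>" and \<beta>: "local_extension saucer_space \<omega> p \<beta>"
    and u: "u \<in> tangent_space saucer_space p" and v: "v \<in> tangent_space saucer_space p"
  shows "ambient_d \<alpha> p [u, v] = ambient_d \<beta> p [u, v]"
proof -
  \<comment> \<open>The correction terms are kept because \<open>(0, snd p)\<close> is not tangent,
    so the two extensions may differ on it.\<close>
  have *: "frechet_derivative (\<lambda>x. \<alpha> x [v]) (at p) u - (snd u \<bullet> snd v) * \<alpha> p [(0, snd p)]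
    = frechet_derivative (\<lambda>x. \<beta> x [v]) (at p) u - (snd u \<bullet> snd v) * \<beta> p [(0, snd p)]"
    if u: "u \<in> tangent_space saucer_space p" and v: "v \<in> tangent_space saucer_space p" for u v
  proof -
    from u obtain \<gamma> e where \<gamma>: "e > 0" "\<gamma> ` {-e<..<e} \<subseteq> saucer_space" "\<gamma> 0 = p"
      "(\<gamma> has_vector_derivative u) (at (0::real))"
      unfolding tangent_space_def by blast
    show ?thesis
      using saucer_extension_derivative[OF \<alpha> \<gamma> v] saucer_extension_derivative[OF \<beta> \<gamma> v]
      by (rule DERIV_unique)
  qed
  from *[OF u v] *[OF v u] show ?thesis
    by (simp add: ambient_d_def inner_commute[of "snd u" "snd v"])
qed

lemma saucer_ext_d_eq:
  assumes "p \<in> saucer_space" "local_extension saucer_space \<omega> p \<alpha>"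
    "u \<in> tangent_space saucer_space p" "v \<in> tangent_space saucer_space p"
  shows "ext_d saucer_space \<omega> p [u, v] = ambient_d \<alpha> p [u, v]"
  unfolding ext_d_def using assms saucer_ambient_d_unique by (intro the_equality) blast+

section \<open>The 2-form of the saucer\<close>

lemma omega0_eq [simp]: "omega0 p [v] = snd p \<bullet> fst v"
  by (simp add: omega0_def)

text \<open>The formula for \<open>omega0\<close> is already smooth and linear on the whole ambient
  space, so only the factor has to be extended.\<close>

lemma local_extension_scaled_omega0:
  assumes U: "open U" "p \<in> U" "smooth_on U g"
    and eq: "\<And>q v. q \<in> saucer_space \<inter> U \<Longrightarrow> v \<in> tangent_space saucer_space q \<Longrightarrow> \<omega> q [v] = g q * omega0 q [v]"
  shows "local_extension saucer_space \<omega> p (\<lambda>x vs. g x * omega0 x vs)"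
proof -
  have "smooth_on U (\<lambda>x. g x * omega0 x [v])" for v
    unfolding omega0_eq
    by (intro smooth_on_bilinear[OF bounded_bilinear_mult] smooth_on_bounded_linear U
        bounded_linear_compose[OF bounded_linear_inner_left bounded_linear_snd])
  moreover have "linear (\<lambda>v. g x * omega0 x [v])" for x
    by (rule linearI) (simp_all add: inner_add_right algebra_simps)
  ultimately show ?thesis
    unfolding local_extension_def using U eq by blast
qed

text \<open>In \<open>dg \<and> omega0 + g d omega0\<close> the first term vanishes, since
  \<open>omega0\<close> kills both vectors.\<close>

lemma ambient_d_scaled_omega0:
  assumes "g differentiable (at p)" "snd p \<bullet> fst u = 0" "snd p \<bullet> fst v = 0"
  shows "ambient_d (\<lambda>x vs. g x * omega0 x vs) p [u, v] = g p * (snd u \<bullet> fst v - snd v \<bullet> fst u)"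
proof -
  have "frechet_derivative (\<lambda>x. g x * omega0 x [w]) (at p) h = g p * (snd h \<bullet> fst w)"
    if "snd p \<bullet> fst w = 0" for w h
  proof -
    have "((\<lambda>x. g x * omega0 x [w]) has_derivative (\<lambda>h. g p * (snd h \<bullet> fst w))) (at p)"
      unfolding omega0_eq
      by (rule derivative_eq_intros assms(1)[unfolded frechet_derivative_works] refl)+ (simp add: that)
    from frechet_derivative_at[OF this] show ?thesis by metis
  qed
  with assms show ?thesis by (simp add: ambient_d_def algebra_simps)
qed

lemma local_extension_omega0: "local_extension saucer_space omega0 p (\<lambda>x vs. 1 * omega0 x vs)"
  by (rule local_extension_scaled_omega0[of UNIV]) (auto intro: smooth_on_const)

text \<open>The formula is \<open>dn \<and> dr\<close>. It is computed directly from
  \<open>omega0\<close>, since here \<open>u\<close> and \<open>v\<close> may leave the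
  distribution.\<close>

lemma Omega_eq:
  assumes p: "p \<in> saucer_space"
    and uv: "u \<in> tangent_space saucer_space p" "v \<in> tangent_space saucer_space p"
  shows "Omega p [u, v] = snd u \<bullet> fst v - snd v \<bullet> fst u"
proof -
  have "frechet_derivative (\<lambda>x. snd x \<bullet> fst w) (at p) h = snd h \<bullet> fst w" for w h :: "(real^3) \<times> (real^3)"
  proof -
    have "((\<lambda>x. snd x \<bullet> fst w) has_derivative (\<lambda>h. snd h \<bullet> fst w)) (at p)"
      by (rule derivative_eq_intros refl)+ simp
    from frechet_derivative_at[OF this] show ?thesis by metis
  qed
  with saucer_ext_d_eq[OF p local_extension_omega0 uv] show ?thesis by (simp add: ambient_d_def)
qed

lemma Omega_nondegenerate:
  assumes p: "p \<in> saucer_space"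
  shows "nondegenerate_on (saucer_distribution p) (Omega p)"
  unfolding nondegenerate_on_def
proof (intro ballI impI)
  fix u assume u: "u \<in> saucer_distribution p" and z: "\<forall>v\<in>saucer_distribution p. Omega p [u, v] = 0"
  \<comment> \<open>Both components obey the same orthogonality condition, so this quarter turn
    preserves the distribution.\<close>
  have "(snd u, - fst u) \<in> saucer_distribution p"
    using u saucer_distribution_eq[OF p] by simp
  moreover from this have "Omega p [u, (snd u, - fst u)] = snd u \<bullet> snd u + fst u \<bullet> fst u"
    using u by (subst Omega_eq[OF p]) (auto simp: saucer_distribution_def form_kernel_def)
  ultimately have "snd u \<bullet> snd u + fst u \<bullet> fst u = 0" using z by force
  then have "snd u = 0 \<and> fst u = 0"
    by (metis add_nonneg_eq_0_iff inner_eq_zero_iff inner_ge_zero)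
  then show "u = 0" by (simp add: prod_eq_iff)
qed

section \<open>Local frames of rank 4\<close>

text \<open>The error of the expansion is orthogonal to a spanning set, hence to itself.\<close>

lemma orthonormal_frame3:
  fixes n :: "real^3"
  assumes "norm n = 1"
  obtains e1 e2 where "norm e1 = 1" "norm e2 = 1" "n \<bullet> e1 = 0" "n \<bullet> e2 = 0" "e1 \<bullet> e2 = 0"
    "\<And>w. w = (w \<bullet> n) *\<^sub>R n + (w \<bullet> e1) *\<^sub>R e1 + (w \<bullet> e2) *\<^sub>R e2"
proof -
  from vector_in_orthonormal_basis[OF assms] obtain S :: "(real^3) set" where
    S: "n \<in> S" "pairwise orthogonal S" "\<And>x. x \<in> S \<Longrightarrow> norm x = 1" "independent S"
      "card S = 3" "span S = UNIV" by auto
  have "card (S - {n}) = 2" using S by simp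
  then obtain e1 e2 where e: "S - {n} = {e1, e2}" "e1 \<noteq> e2" by (meson card_2_iff)
  then have Se: "S = {n, e1, e2}" "n \<noteq> e1" "n \<noteq> e2" using S(1) by auto
  have o: "n \<bullet> e1 = 0" "n \<bullet> e2 = 0" "e1 \<bullet> e2 = 0" "e1 \<bullet> n = 0" "e2 \<bullet> n = 0" "e2 \<bullet> e1 = 0"
    using S(2) Se e(2) by (auto simp: pairwise_def orthogonal_def)
  have u: "n \<bullet> n = 1" "e1 \<bullet> e1 = 1" "e2 \<bullet> e2 = 1"
    using S(3) Se(1) by (simp_all add: dot_square_norm)
  have "w = (w \<bullet> n) *\<^sub>R n + (w \<bullet> e1) *\<^sub>R e1 + (w \<bullet> e2) *\<^sub>R e2" for w
  proof -
    have "orthogonal (w - ((w \<bullet> n) *\<^sub>R n + (w \<bullet> e1) *\<^sub>R e1 + (w \<bullet> e2) *\<^sub>R e2)) s" if "s \<in> S" for s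
      using that o u unfolding Se(1)
      by (auto simp: orthogonal_def inner_diff_left inner_add_left)
    then have "orthogonal (w - ((w \<bullet> n) *\<^sub>R n + (w \<bullet> e1) *\<^sub>R e1 + (w \<bullet> e2) *\<^sub>R e2)) y" for y
      using orthogonal_to_span S(6) by blast
    then show ?thesis using orthogonal_self by (metis eq_iff_diff_eq_0)
  qed
  then show ?thesis using that o S(3) Se(1) by blast
qed

text \<open>Since \<open>n \<bullet> m \<noteq> 0\<close>, \<open>w\<close> can be shifted along
  \<open>n\<close> until it is orthogonal to \<open>m\<close>, where \<open>e1\<close> and
  \<open>e2\<close> span. Projecting back along \<open>n\<close> undoes the shift.\<close>

lemma span_projected_frame:
  fixes n :: "real^3"
  assumes n: "norm n = 1" and nn: "n \<bullet> m \<noteq> 0"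
    and m: "\<And>w. w = (w \<bullet> m) *\<^sub>R m + (w \<bullet> e1) *\<^sub>R e1 + (w \<bullet> e2) *\<^sub>R e2"
    and w: "n \<bullet> w = 0"
  shows "\<exists>a b. w = a *\<^sub>R (e1 - (e1 \<bullet> n) *\<^sub>R n) + b *\<^sub>R (e2 - (e2 \<bullet> n) *\<^sub>R n)"
proof -
  define z where "z = w - ((w \<bullet> m) / (n \<bullet> m)) *\<^sub>R n"
  have "z \<bullet> m = 0" using nn by (simp add: z_def inner_diff_left)
  then have z: "z = (z \<bullet> e1) *\<^sub>R e1 + (z \<bullet> e2) *\<^sub>R e2" using m[of z] by simp
  have "w = z - (z \<bullet> n) *\<^sub>R n"
    using n w by (simp add: z_def inner_diff_left inner_commute[of w n] norm_eq_1)
  also have "\<dots> = (z \<bullet> e1) *\<^sub>R (e1 - (e1 \<bullet> n) *\<^sub>R n) + (z \<bullet> e2) *\<^sub>R (e2 - (e2 \<bullet> n) *\<^sub>R n)"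
    by (subst (1 2) z) (simp add: algebra_simps)
  finally show ?thesis by blast
qed

text \<open>A basis of the plane orthogonal to the normal at \<open>p\<close> is projected to the
  planes of nearby points and placed in either factor. Each fibre is the square of such a plane,
  whence rank \<open>2 + 2\<close>.\<close>

lemma smooth_saucer_distribution: "smooth_distribution saucer_space 4 saucer_distribution"
  unfolding smooth_distribution_def
proof
  fix p assume p: "p \<in> saucer_space"
  define m where "m = snd p"
  have m1: "norm m = 1" using p by (auto simp: m_def saucer_space_def)
  from orthonormal_frame3[OF m1] obtain e1 e2 where
    m: "\<And>w. w = (w \<bullet> m) *\<^sub>R m + (w \<bullet> e1) *\<^sub>R e1 + (w \<bullet> e2) *\<^sub>R e2" by metis
  define P where "P e x = e - (e \<bullet> snd x) *\<^sub>R snd x" for e and x :: "(real^3) \<times> (real^3)"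
  define X where "X i x = (if i = 0 then (P e1 x, 0) else if i = 1 then (P e2 x, 0)
     else if i = 2 then (0, P e1 x) else (0, P e2 x))" for i :: nat and x
  \<comment> \<open>On this open set the projected vectors still span, by
    \<open>span_projected_frame\<close>.\<close>
  define U where "U = {x::(real^3) \<times> (real^3). snd x \<bullet> m \<noteq> 0}"
  have U: "open U" unfolding U_def by (intro open_Collect_neq continuous_intros)
  have "smooth_on U (\<lambda>x. (e, 0) + (- (e \<bullet> snd x)) *\<^sub>R (snd x, 0))"
    "smooth_on U (\<lambda>x. (0, e) + (- (e \<bullet> snd x)) *\<^sub>R (0, snd x))" for e
    by (intro smooth_on_add smooth_on_const smooth_on_bilinear[OF bounded_bilinear_scaleR]
        smooth_on_bounded_linear U bounded_linear_minus bounded_linear_Pair bounded_linear_zero bounded_linear_snd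
        bounded_linear_compose[OF bounded_linear_inner_right bounded_linear_snd])+
  then have sm: "smooth_on U (\<lambda>x. (P e x, 0))" "smooth_on U (\<lambda>x. (0, P e x))" for e
    by (auto simp: P_def)
  have smX: "smooth_on U (X i)" for i
    unfolding X_def[abs_def] by (cases "i = 0"; cases "i = 1"; cases "i = 2") (auto simp: sm)
  have sub: "saucer_distribution q \<subseteq> tangent_space saucer_space q"
    for q by (auto simp: saucer_distribution_def form_kernel_def)
  have frame: "saucer_distribution q = span ((\<lambda>i. X i q) ` {..<4})" "dim (saucer_distribution q) = 4"
    if q: "q \<in> saucer_space \<inter> U" for q
  proof -
    let ?H = "{w. snd q \<bullet> w = 0}"
    have q1: "norm (snd q) = 1" using q by (auto simp: saucer_space_def)
    have D: "saucer_distribution q = ?H \<times> ?H"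
      using saucer_distribution_eq q by auto
    have "snd q \<noteq> 0" using q1 by auto
    then have "dim ?H = 2" by (simp add: dim_hyperplane)
    then show "dim (saucer_distribution q) = 4"
      unfolding D by (simp add: dim_Times subspace_hyperplane)
    have H: "P e q \<in> ?H" for e
      using q1 by (simp add: P_def inner_diff_right norm_eq_1 inner_commute)
    have im: "(\<lambda>i. X i q) ` {..<4} = {(P e1 q, 0), (P e2 q, 0), (0, P e1 q), (0, P e2 q)}"
    proof -
      have "{..<4} = {0, 1, 2, 3::nat}" by auto
      then show ?thesis by (simp add: X_def insert_commute)
    qed
    show "saucer_distribution q = span ((\<lambda>i. X i q) ` {..<4})"
    proof
      show "span ((\<lambda>i. X i q) ` {..<4}) \<subseteq> saucer_distribution q"
        unfolding D im using H by (intro span_minimal subspace_Times subspace_hyperplane) auto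
      show "saucer_distribution q \<subseteq> span ((\<lambda>i. X i q) ` {..<4})"
      proof
        fix v assume v: "v \<in> saucer_distribution q"
        have "\<exists>a b. w = a *\<^sub>R P e1 q + b *\<^sub>R P e2 q" if "w \<in> ?H" for w
          using span_projected_frame[OF q1 _ m, of w] that q unfolding P_def U_def by blast
        then obtain a b c d where "fst v = a *\<^sub>R P e1 q + b *\<^sub>R P e2 q" "snd v = c *\<^sub>R P e1 q + d *\<^sub>R P e2 q"
          using v unfolding D by (metis mem_Times_iff)
        then have veq: "v = a *\<^sub>R (P e1 q, 0) + b *\<^sub>R (P e2 q, 0) + c *\<^sub>R (0, P e1 q) + d *\<^sub>R (0, P e2 q)"
          by (simp add: prod_eq_iff)
        show "v \<in> span ((\<lambda>i. X i q) ` {..<4})"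
          unfolding im veq by (intro span_add span_scale span_base) simp_all
      qed
    qed
  qed
  have pU: "p \<in> U" using m1 by (auto simp: U_def m_def)
  show "\<exists>U X. open U \<and> p \<in> U \<and> (\<forall>i<4::nat. smooth_on U (X i)) \<and>
      (\<forall>q\<in>saucer_space \<inter> U. saucer_distribution q \<subseteq> tangent_space saucer_space q \<and>
        saucer_distribution q = span ((\<lambda>i. X i q) ` {..<4}) \<and> dim (saucer_distribution q) = 4)"
    by (intro exI[of _ U] exI[of _ X] conjI allI impI ballI U pU smX sub frame)
qed

section \<open>The contact condition\<close>

lemma contact_form_nonzero:
  assumes p: "p \<in> saucer_space"
  shows "nonzero_form_at saucer_space 5 (wedge 4 1 (wedge 2 2 Omega Omega) omega0) p"
proof -
  have n: "norm (snd p) = 1" using p by (auto simp: saucer_space_def)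
  from orthonormal_frame3[OF n] obtain e1 e2 where
    e: "norm e1 = 1" "norm e2 = 1" "snd p \<bullet> e1 = 0" "snd p \<bullet> e2 = 0" "e1 \<bullet> e2 = 0" by metis
  have o: "e2 \<bullet> e1 = 0" "e1 \<bullet> e1 = 1" "e2 \<bullet> e2 = 1"
    using e by (simp_all add: dot_square_norm inner_commute)
  \<comment> \<open>Two conjugate pairs for \<open>Omega\<close> spanning the distribution, then the
    transverse vector, on which \<open>omega0\<close> is 1; the 5-form takes the value 2.\<close>
  define vs where "vs = [(e1, 0), (0, e1), (e2, 0), (0, e2), (snd p, 0::real^3)]"
  have len: "length vs = 5" by (simp add: vs_def)
  have T: "set vs \<subseteq> tangent_space saucer_space p"
    using e by (simp add: vs_def saucer_tangent_space[OF p])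
  have lt4: "i = 0 \<or> i = 1 \<or> i = 2 \<or> i = 3" if "i < 4" for i :: nat
    using that by linarith
  have "wedge 2 2 Omega Omega p (take 4 vs) = 2"
  proof (rule wedge_two_forms_four_vectors)
    fix i j :: nat assume ij: "i < 4" "j < 4"
    then have "vs ! i \<in> set vs" "vs ! j \<in> set vs"
      by (auto intro!: nth_mem simp: len)
    then have "Omega p [vs ! i, vs ! j] = snd (vs ! i) \<bullet> fst (vs ! j) - snd (vs ! j) \<bullet> fst (vs ! i)"
      using T by (intro Omega_eq[OF p]) auto
    then show "Omega p [take 4 vs ! i, take 4 vs ! j] =
     (if (i, j) = (0, 1) \<or> (i, j) = (2, 3) then -1 else if (i, j) = (1, 0) \<or> (i, j) = (3, 2) then 1 else 0)"
      using lt4[OF ij(1)] lt4[OF ij(2)] e(5) o by (elim disjE) (simp_all add: vs_def)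
  qed
  moreover have "wedge 4 1 (wedge 2 2 Omega Omega) omega0 p vs
      = wedge 2 2 Omega Omega p (take 4 vs) * omega0 p [vs ! 4]"
  proof (rule wedge_one_form_right)
    fix \<pi> :: "nat \<Rightarrow> nat" assume \<pi>: "\<pi> permutes {..<4}"
    have "\<pi> i < 4" if "i < 4" for i
      using permutes_in_image[OF \<pi>, of i] that by simp
    then have eq: "map (\<lambda>i. vs ! \<pi> i) [0..<4] = map (\<lambda>i. take 4 vs ! \<pi> i) [0..<2 + 2]"
      by auto
    show "wedge 2 2 Omega Omega p (map (\<lambda>i. vs ! \<pi> i) [0..<4])
        = of_int (sign \<pi>) * wedge 2 2 Omega Omega p (take 4 vs)"
      unfolding eq by (rule wedge_permute) (simp add: \<pi>)
  next
    fix i :: nat assume "i < 4"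
    then show "omega0 p [vs ! i] = 0"
      using lt4[of i] e by (auto simp: vs_def)
  qed (simp add: vs_def)
  moreover have "omega0 p [vs ! 4] = 1" using n by (simp add: vs_def norm_eq_1)
  ultimately show ?thesis
    unfolding nonzero_form_at_def using T by (intro exI[of _ vs]) (simp add: vs_def)
qed

section \<open>Uniqueness up to scale\<close>

text \<open>\<open>f\<close> is smooth because \<open>(snd x, 0)\<close> is a smooth field on the
  ambient space, and nonzero because this field avoids the common kernel.\<close>

lemma scaled_omega0_if_same_kernel:
  assumes \<omega>: "smooth_one_form saucer_space \<omega>"
    and ker: "\<And>p. p \<in> saucer_space \<Longrightarrow> form_kernel saucer_space \<omega> p = saucer_distribution p"
  obtains f where "smooth_function saucer_space f" "\<And>p. p \<in> saucer_space \<Longrightarrow> f p \<noteq> 0"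
    "\<And>p v. p \<in> saucer_space \<Longrightarrow> v \<in> tangent_space saucer_space p \<Longrightarrow> \<omega> p [v] = f p * omega0 p [v]"
proof -
  define f where "f p = \<omega> p [(snd p, 0)]" for p
  have N: "(snd p, 0) \<in> tangent_space saucer_space p" "snd p \<bullet> snd p = 1" if "p \<in> saucer_space" for p
    using that by (simp_all add: saucer_tangent_space[OF that])
       (auto simp: saucer_space_def dot_square_norm)
  have "smooth_function saucer_space f"
    unfolding smooth_function_def
  proof
    fix p assume p: "p \<in> saucer_space"
    with \<omega> obtain \<alpha> where "local_extension saucer_space \<omega> p \<alpha>"
      unfolding smooth_one_form_def by blast
    then obtain U where U: "open U" "p \<in> U" and lin: "\<And>x. x \<in> U \<Longrightarrow> linear (\<lambda>v. \<alpha> x [v])"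
      and sm: "\<And>v. smooth_on U (\<lambda>x. \<alpha> x [v])"
      and eq: "\<And>q v. q \<in> saucer_space \<inter> U \<Longrightarrow> v \<in> tangent_space saucer_space q \<Longrightarrow> \<omega> q [v] = \<alpha> q [v]"
      unfolding local_extension_def by blast
    have "bounded_linear (\<lambda>x::(real^3) \<times> (real^3). (snd x, 0::real^3))"
      by (intro bounded_linear_Pair bounded_linear_zero bounded_linear_snd)
    from smooth_on_form_apply[OF U(1) lin sm smooth_on_bounded_linear[OF this U(1)]]
    have "smooth_on U (\<lambda>x. \<alpha> x [(snd x, 0)])" .
    then show "\<exists>U g. open U \<and> p \<in> U \<and> smooth_on U g \<and> (\<forall>q\<in>saucer_space \<inter> U. f q = g q)"
      using U eq N by (intro exI[of _ U] exI[of _ "\<lambda>x. \<alpha> x [(snd x, 0)]"]) (auto simp: f_def)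
  qed
  moreover have "f p \<noteq> 0" if p: "p \<in> saucer_space" for p
  proof
    assume "f p = 0"
    then have "(snd p, 0) \<in> saucer_distribution p"
      using N(1)[OF p] by (simp add: ker[OF p, symmetric] form_kernel_def f_def)
    then show False using N(2)[OF p] saucer_distribution_eq[OF p] by simp
  qed
  moreover have "\<omega> p [v] = f p * omega0 p [v]"
    if p: "p \<in> saucer_space" and v: "v \<in> tangent_space saucer_space p" for p v
  proof -
    \<comment> \<open>A form is an arbitrary function on lists, so linearity of
      \<open>\<omega>\<close> at \<open>p\<close> is taken from a local extension.\<close>
    from \<omega> p obtain \<alpha> where "local_extension saucer_space \<omega> p \<alpha>"
      unfolding smooth_one_form_def by blast
    then obtain U where U: "p \<in> U" and lin: "\<And>x. x \<in> U \<Longrightarrow> linear (\<lambda>v. \<alpha> x [v])"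
      and eq: "\<And>q v. q \<in> saucer_space \<inter> U \<Longrightarrow> v \<in> tangent_space saucer_space q \<Longrightarrow> \<omega> q [v] = \<alpha> q [v]"
      unfolding local_extension_def by blast
    \<comment> \<open>Removing the transverse part of \<open>v\<close> leaves a vector of the common
      kernel.\<close>
    let ?w = "v - omega0 p [v] *\<^sub>R (snd p, 0)"
    have "?w \<in> saucer_distribution p"
      using v N[OF p] saucer_tangent_space[OF p] saucer_distribution_eq[OF p]
      by (simp add: inner_diff_right)
    then have "?w \<in> tangent_space saucer_space p" "\<omega> p [?w] = 0"
      using ker[OF p] by (auto simp: form_kernel_def)
    then have "\<alpha> p [?w] = 0" using eq p U by simp
    then have "\<alpha> p [v] = omega0 p [v] * \<alpha> p [(snd p, 0)]"
      using linear_diff[OF lin[OF U]] linear_scale[OF lin[OF U], of "omega0 p [v]" "(snd p, 0)"] by simp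
    then show ?thesis
      using eq[of p] p U v N(1)[OF p] by (simp add: f_def)
  qed
  ultimately show ?thesis using that by blast
qed

lemma same_kernel_if_scaled_omega0:
  assumes f: "smooth_function saucer_space f" "\<And>p. p \<in> saucer_space \<Longrightarrow> f p \<noteq> 0"
    and eq: "\<And>p v. p \<in> saucer_space \<Longrightarrow> v \<in> tangent_space saucer_space p \<Longrightarrow> \<omega> p [v] = f p * omega0 p [v]"
  shows "smooth_one_form saucer_space \<omega>"
    and "p \<in> saucer_space \<Longrightarrow> form_kernel saucer_space \<omega> p = saucer_distribution p"
proof -
  show "smooth_one_form saucer_space \<omega>"
    unfolding smooth_one_form_def
  proof
    fix p assume p: "p \<in> saucer_space"
    with f obtain U g where "open U" "p \<in> U" "smooth_on U g" "\<forall>q\<in>saucer_space \<inter> U. f q = g q"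
      unfolding smooth_function_def by blast
    then have "local_extension saucer_space \<omega> p (\<lambda>x vs. g x * omega0 x vs)"
      using eq by (intro local_extension_scaled_omega0) auto
    then show "\<exists>\<alpha>. local_extension saucer_space \<omega> p \<alpha>" by blast
  qed
  show "form_kernel saucer_space \<omega> p = saucer_distribution p" if "p \<in> saucer_space"
    using f(2)[OF that] eq[OF that]
    unfolding form_kernel_def saucer_distribution_def by (intro Collect_cong conj_cong) simp_all
qed

text \<open>Near \<open>p\<close> the factor \<open>f\<close> extends to some \<open>g\<close>, and
  \<open>ext_d\<close> may be computed from the extension \<open>g * omega0\<close>.\<close>

lemma ext_d_scaled_omega0:
  assumes f: "smooth_function saucer_space f"
    and eq: "\<And>p v. p \<in> saucer_space \<Longrightarrow> v \<in> tangent_space saucer_space p \<Longrightarrow> \<omega> p [v] = f p * omega0 p [v]"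
    and p: "p \<in> saucer_space" and uv: "u \<in> saucer_distribution p" "v \<in> saucer_distribution p"
  shows "ext_d saucer_space \<omega> p [u, v] = f p * Omega p [u, v]"
proof -
  from f p obtain U g where g: "open U" "p \<in> U" "smooth_on U g" "\<forall>q\<in>saucer_space \<inter> U. f q = g q"
    unfolding smooth_function_def by blast
  then have ext: "local_extension saucer_space \<omega> p (\<lambda>x vs. g x * omega0 x vs)"
    using eq by (intro local_extension_scaled_omega0) auto
  have T: "u \<in> tangent_space saucer_space p" "v \<in> tangent_space saucer_space p"
    using uv by (auto simp: saucer_distribution_def form_kernel_def)
  have "g differentiable (at p)"
    using smooth_on_has_derivative[OF g(3,2)] by (auto simp: differentiable_def)
  then have "ambient_d (\<lambda>x vs. g x * omega0 x vs) p [u, v] = g p * (snd u \<bullet> fst v - snd v \<bullet> fst u)"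
    using uv saucer_distribution_eq[OF p] by (intro ambient_d_scaled_omega0) auto
  then show ?thesis
    using saucer_ext_d_eq[OF p ext T] Omega_eq[OF p T] g p by simp
qed

theorem proposition1p1:
  shows "smooth_one_form saucer_space omega0 \<and>
    smooth_distribution saucer_space 4 saucer_distribution \<and>
    (\<forall>p\<in>saucer_space.
       nonzero_form_at saucer_space 5 (wedge 4 1 (wedge 2 2 Omega Omega) omega0) p) \<and>
    (\<forall>\<omega>. smooth_one_form saucer_space \<omega> \<and>
          (\<forall>p\<in>saucer_space. form_kernel saucer_space \<omega> p = saucer_distribution p)
        \<longleftrightarrow>
          (\<exists>f. smooth_function saucer_space f \<and> (\<forall>p\<in>saucer_space. f p \<noteq> 0) \<and>
               (\<forall>p\<in>saucer_space. \<forall>v\<in>tangent_space saucer_space p.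
                  \<omega> p [v] = f p * omega0 p [v]))) \<and>
    (\<forall>p\<in>saucer_space. nondegenerate_on (saucer_distribution p) (Omega p)) \<and>
    (\<forall>\<omega>. smooth_one_form saucer_space \<omega> \<and>
          (\<forall>p\<in>saucer_space. form_kernel saucer_space \<omega> p = saucer_distribution p)
        \<longrightarrow>
          (\<exists>f. smooth_function saucer_space f \<and> (\<forall>p\<in>saucer_space. f p \<noteq> 0) \<and>
               (\<forall>p\<in>saucer_space. \<forall>u\<in>saucer_distribution p. \<forall>v\<in>saucer_distribution p.
                  ext_d saucer_space \<omega> p [u, v] = f p * Omega p [u, v])))"
proof (intro conjI allI ballI iffI impI)
  show "smooth_one_form saucer_space omega0"
    using local_extension_omega0 by (auto simp: smooth_one_form_def)
next
  fix \<omega>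
  assume "smooth_one_form saucer_space \<omega> \<and>
    (\<forall>p\<in>saucer_space. form_kernel saucer_space \<omega> p = saucer_distribution p)"
  then obtain f where f: "smooth_function saucer_space f" "\<And>p. p \<in> saucer_space \<Longrightarrow> f p \<noteq> 0"
    "\<And>p v. p \<in> saucer_space \<Longrightarrow> v \<in> tangent_space saucer_space p \<Longrightarrow> \<omega> p [v] = f p * omega0 p [v]"
    using scaled_omega0_if_same_kernel[of \<omega>] by blast
  then show "\<exists>f. smooth_function saucer_space f \<and> (\<forall>p\<in>saucer_space. f p \<noteq> 0) \<and>
               (\<forall>p\<in>saucer_space. \<forall>v\<in>tangent_space saucer_space p. \<omega> p [v] = f p * omega0 p [v])"
    by blast
  \<comment> \<open>The factor relating the 1-forms also relates their exterior derivatives on the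
    distribution.\<close>
  from f show "\<exists>f. smooth_function saucer_space f \<and> (\<forall>p\<in>saucer_space. f p \<noteq> 0) \<and>
               (\<forall>p\<in>saucer_space. \<forall>u\<in>saucer_distribution p. \<forall>v\<in>saucer_distribution p.
                  ext_d saucer_space \<omega> p [u, v] = f p * Omega p [u, v])"
    using ext_d_scaled_omega0[of f \<omega>] by blast
next
  fix \<omega>
  assume "\<exists>f. smooth_function saucer_space f \<and> (\<forall>p\<in>saucer_space. f p \<noteq> 0) \<and>
               (\<forall>p\<in>saucer_space. \<forall>v\<in>tangent_space saucer_space p. \<omega> p [v] = f p * omega0 p [v])"
  then obtain f where f: "smooth_function saucer_space f" "\<And>p. p \<in> saucer_space \<Longrightarrow> f p \<noteq> 0"
    "\<And>p v. p \<in> saucer_space \<Longrightarrow> v \<in> tangent_space saucer_space p \<Longrightarrow> \<omega> p [v] = f p * omega0 p [v]"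
    by blast
  show "smooth_one_form saucer_space \<omega>"
    by (rule same_kernel_if_scaled_omega0(1)[OF f])
  show "form_kernel saucer_space \<omega> p = saucer_distribution p" if "p \<in> saucer_space" for p
    by (rule same_kernel_if_scaled_omega0(2)[OF f that])
qed (simp_all add: smooth_saucer_distribution contact_form_nonzero[simplified] Omega_nondegenerate)

end
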